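(* Let $N$ be a finite set with $|N|\geq 3$. If $\mathcal{B}$ is a min-balanced set system on $N$ such that $|\mathcal{B}|\geq 3$ and $Z\in\mathcal{B}$, then $Y:=N\setminus Z$ is not in $\mathcal{B}$, the set system $\mathcal{S}:=(\mathcal{B}\setminus\{Z\})\cup\{Y\}$ is purely min-semi-balanced on $N$, and $Y$ is the exceptional set within $\mathcal{S}$. Conversely, if $\mathcal{S}$ is a (purely) min-semi-balanced system on $N$ and $Y\in\mathcal{S}$ is the exceptional set within $\mathcal{S}$, then $Z:=N\setminus Y$ is not in $\mathcal{S}$ and $\mathcal{B}:=(\mathcal{S}\setminus\{Y\})\cup\{Z\}$ is a min-balanced system on $N$ such that $|\mathcal{B}|\geq 3$.
   Context: $\mathcal{P}(N)$ is the power set of $N$, $\subset$ is strict inclusion, and $\chi_S\in\mathbb{R}^N$ is the incidence vector of $S\subseteq N$. A constant vector in $\mathbb{R}^N$ is a vector $[r,\ldots,r]$, $r\in\mathbb{R}$. A linear combination is conic if all coefficients are $\geq 0$, and semi-conic if at most one coefficient is strictly negative. A non-trivial set system on $N$ is a system $\mathcal{S}$ with $\emptyset\neq\mathcal{S}\subseteq\mathcal{P}(N)\setminus\{\emptyset,N\}$. It is balanced (on $N$) if $\chi_N$ is a conic combination of $\{\chi_S:S\in\mathcal{S}\}$ with all coefficients non-zero. It is semi-balanced (on $N$) if some constant vector in $\mathbb{R}^N$ is a semi-conic combination of $\{\chi_S:S\in\mathcal{S}\}$ with all coefficients non-zero. It is min-balanced (min-semi-balanced) if it is balanced (semi-balanced)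 and has no strict subsystem that is balanced (semi-balanced) on $N$. It is purely min-semi-balanced if it is min-semi-balanced and not balanced. A set $T\in\mathcal{S}$ is exceptional within $\mathcal{S}$ if there is a linear combination $\sum_{S\in\mathcal{S}}\lambda_S\chi_S$ yielding a constant vector in $\mathbb{R}^N$ with $\lambda_T<0$ and $\lambda_S\geq 0$ for $S\in\mathcal{S}\setminus\{T\}$. A purely min-semi-balanced system has exactly one exceptional set. *)

theory Defs
  imports Complex_Main "HOL-Library.Indicator_Function"
begin

(* Vectors in R^N are functions 'a \<Rightarrow> real of which only the values on N matter;
   identities in R^N are stated pointwise on N. The incidence vector of S is "indicator S". *)

definition nontrivial_system :: "'a set \<Rightarrow> 'a set set \<Rightarrow> bool" where
  "nontrivial_system N \<S> \<longleftrightarrow> \<S> \<noteq> {} \<and> \<S> \<subseteq> Pow N - {{}, N}"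

definition lin_comb :: "'a set set \<Rightarrow> ('a set \<Rightarrow> real) \<Rightarrow> 'a \<Rightarrow> real" where
  "lin_comb \<S> l i = (\<Sum>S\<in>\<S>. l S * indicator S i)"

definition constant_on :: "'a set \<Rightarrow> ('a \<Rightarrow> real) \<Rightarrow> bool" where
  "constant_on N x \<longleftrightarrow> (\<exists>r. \<forall>i\<in>N. x i = r)"

definition conic :: "'a set set \<Rightarrow> ('a set \<Rightarrow> real) \<Rightarrow> bool" where
  "conic \<S> l \<longleftrightarrow> (\<forall>S\<in>\<S>. l S \<ge> 0)"

definition semi_conic :: "'a set set \<Rightarrow> ('a set \<Rightarrow> real) \<Rightarrow> bool" where
  "semi_conic \<S> l \<longleftrightarrow> (\<exists>\<^sub>\<le>\<^sub>1 S. S \<in> \<S> \<and> l S < 0)"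

definition balanced :: "'a set \<Rightarrow> 'a set set \<Rightarrow> bool" where
  "balanced N \<S> \<longleftrightarrow> nontrivial_system N \<S> \<and>
     (\<exists>l. conic \<S> l \<and> (\<forall>S\<in>\<S>. l S \<noteq> 0) \<and> (\<forall>i\<in>N. lin_comb \<S> l i = indicator N i))"

definition semi_balanced :: "'a set \<Rightarrow> 'a set set \<Rightarrow> bool" where
  "semi_balanced N \<S> \<longleftrightarrow> nontrivial_system N \<S> \<and>
     (\<exists>l. semi_conic \<S> l \<and> (\<forall>S\<in>\<S>. l S \<noteq> 0) \<and> constant_on N (lin_comb \<S> l))"

definition min_balanced :: "'a set \<Rightarrow> 'a set set \<Rightarrow> bool" where
  "min_balanced N \<S> \<longleftrightarrow> balanced N \<S> \<and> \<not> (\<exists>\<T>. \<T> \<subset> \<S> \<and> balanced N \<T>)"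

definition min_semi_balanced :: "'a set \<Rightarrow> 'a set set \<Rightarrow> bool" where
  "min_semi_balanced N \<S> \<longleftrightarrow> semi_balanced N \<S> \<and> \<not> (\<exists>\<T>. \<T> \<subset> \<S> \<and> semi_balanced N \<T>)"

definition purely_min_semi_balanced :: "'a set \<Rightarrow> 'a set set \<Rightarrow> bool" where
  "purely_min_semi_balanced N \<S> \<longleftrightarrow> min_semi_balanced N \<S> \<and> \<not> balanced N \<S>"

definition exceptional :: "'a set \<Rightarrow> 'a set set \<Rightarrow> 'a set \<Rightarrow> bool" where
  "exceptional N \<S> T \<longleftrightarrow> T \<in> \<S> \<and>
     (\<exists>l. constant_on N (lin_comb \<S> l) \<and> l T < 0 \<and> (\<forall>S\<in>\<S> - {T}. l S \<ge> 0))"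

end

(* Since chi_Z = chi_N - chi_(N - Z), exchanging Z for its complement in a set system carries the
   linear combinations yielding constant vectors to each other, negating one coefficient.
   A positive combination on a min-balanced system B is, up to a factor, the only combination on B
   yielding a constant vector: subtracting another one from a suitable multiple would otherwise
   give a conic combination with smaller support. So the combinations on the exchanged system are
   the multiples of one with a single negative coefficient, at N - Z. Conversely, a conic
   combination with smaller support on B would be carried to a semi-conic one. *)

theory Submission
  imports Defs
begin

section \<open>Linear combinations and the exchange of a set for its complement\<close>

lemma finite_system:
  assumes "finite N" "nontrivial_system N \<S>"
  shows "finite \<S>"
  using assms by (meson Diff_subset finite_Pow_iff finite_subset nontrivial_system_def)

lemma constant_on_linear:
  assumes "constant_on N (lin_comb \<S> l)" "constant_on N (lin_comb \<S> m)"
  shows "constant_on N (lin_comb \<S> (\<lambda>S. a * l S + b * m S))"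
proof -
  have "lin_comb \<S> (\<lambda>S. a * l S + b * m S) i = a * lin_comb \<S> l i + b * lin_comb \<S> m i" for i
    by (simp add: lin_comb_def sum_distrib_left sum.distrib algebra_simps)
  then show ?thesis
    using assms unfolding constant_on_def by auto
qed

lemma lin_comb_support:
  assumes "finite \<S>"
  shows "lin_comb {S \<in> \<S>. l S \<noteq> 0} l = lin_comb \<S> l"
  unfolding lin_comb_def using assms
  by (intro ext sum.mono_neutral_left) auto

lemma lin_comb_extend_zero:
  assumes "finite \<S>" "\<T> \<subseteq> \<S>"
  shows "lin_comb \<S> (\<lambda>S. if S \<in> \<T> then l S else 0) = lin_comb \<T> l"
  unfolding lin_comb_def using assms
  by (intro ext sum.mono_neutral_cong_right) auto

text \<open>On \<open>N\<close> the indicator of \<open>N - Z\<close> is one minus that of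
  \<open>Z\<close>, so negating the coefficient only shifts the combination by the constant
  \<open>l Z\<close>. Since \<open>N - Z\<close> is not in \<open>\<B>\<close>, the update
  overwrites no coefficient still in use, and \<open>Z\<close> itself is absent from the exchanged
  system.\<close>

lemma lin_comb_exchange:
  assumes "finite \<B>" "Z \<in> \<B>" "N - Z \<notin> \<B>" "i \<in> N"
  shows "lin_comb (\<B> - {Z} \<union> {N - Z}) (l(N - Z := - l Z)) i = lin_comb \<B> l i - l Z"
proof -
  have "lin_comb (\<B> - {Z} \<union> {N - Z}) (l(N - Z := - l Z)) i
      = - l Z * indicator (N - Z) i + (\<Sum>S\<in>\<B> - {Z}. (l(N - Z := - l Z)) S * indicator S i)"
    unfolding lin_comb_def using assms by simp
  also have "(\<Sum>S\<in>\<B> - {Z}. (l(N - Z := - l Z)) S * indicator S i)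
      = (\<Sum>S\<in>\<B> - {Z}. l S * indicator S i)"
    using assms(3) by (intro sum.cong) auto
  also have "\<dots> = lin_comb \<B> l i - l Z * indicator Z i"
    unfolding lin_comb_def using assms(1,2) by (simp add: sum_diff1)
  finally show ?thesis
    using assms(4) by (cases "i \<in> Z") (simp_all del: fun_upd_apply)
qed

lemma constant_on_exchange:
  assumes "finite \<B>" "Z \<in> \<B>" "N - Z \<notin> \<B>" "constant_on N (lin_comb \<B> l)"
  shows "constant_on N (lin_comb (\<B> - {Z} \<union> {N - Z}) (l(N - Z := - l Z)))"
  using assms(4) lin_comb_exchange[OF assms(1-3)] unfolding constant_on_def by auto

lemma nontrivial_exchange:
  assumes "nontrivial_system N \<B>" "Z \<in> \<B>"
  shows "nontrivial_system N (\<B> - {Z} \<union> {N - Z})"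
  using assms unfolding nontrivial_system_def by fastforce

section \<open>Positive combinations and supports\<close>

text \<open>The target vector may be any constant instead of the all-one vector, which gives
  balanced systems the same form as semi-balanced ones. A constant reached with positive
  coefficients is itself positive: at a point of some member \<open>A\<close> it is at least the
  coefficient of \<open>A\<close>. Dividing by it gives the incidence vector of
  \<open>N\<close>.\<close>

lemma balanced_iff:
  assumes "finite N"
  shows "balanced N \<S> \<longleftrightarrow> nontrivial_system N \<S> \<and>
    (\<exists>l. (\<forall>S\<in>\<S>. l S > 0) \<and> constant_on N (lin_comb \<S> l))"
proof
  assume "balanced N \<S>"
  then obtain l where l: "nontrivial_system N \<S>" "\<forall>S\<in>\<S>. l S \<ge> 0" "\<forall>S\<in>\<S>. l S \<noteq> 0"
      "\<forall>i\<in>N. lin_comb \<S> l i = indicator N i"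
    unfolding balanced_def conic_def by blast
  then have "\<forall>S\<in>\<S>. l S > 0"
    by (metis order_le_imp_less_or_eq)
  moreover have "constant_on N (lin_comb \<S> l)"
    using l(4) unfolding constant_on_def by auto
  ultimately show "nontrivial_system N \<S> \<and>
      (\<exists>l. (\<forall>S\<in>\<S>. l S > 0) \<and> constant_on N (lin_comb \<S> l))"
    using l(1) by blast
next
  assume "nontrivial_system N \<S> \<and> (\<exists>l. (\<forall>S\<in>\<S>. l S > 0) \<and> constant_on N (lin_comb \<S> l))"
  then obtain l r where nt: "nontrivial_system N \<S>" and pos: "\<And>S. S \<in> \<S> \<Longrightarrow> l S > 0"
      and r: "\<And>i. i \<in> N \<Longrightarrow> lin_comb \<S> l i = r"
    unfolding constant_on_def by blast
  obtain A i where A: "A \<in> \<S>" "i \<in> A" "i \<in> N"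
    using nt unfolding nontrivial_system_def by fastforce
  have "l A * indicator A i \<le> lin_comb \<S> l i"
    unfolding lin_comb_def using A pos finite_system[OF assms nt]
    by (intro member_le_sum) (auto simp: less_imp_le)
  then have "r > 0"
    using A pos[OF A(1)] r[OF A(3)] by simp
  moreover have "lin_comb \<S> (\<lambda>S. l S / r) i = lin_comb \<S> l i / r" for i
    by (simp add: lin_comb_def sum_divide_distrib)
  ultimately have "conic \<S> (\<lambda>S. l S / r)" "\<forall>S\<in>\<S>. l S / r \<noteq> 0"
      "\<forall>i\<in>N. lin_comb \<S> (\<lambda>S. l S / r) i = indicator N i"
    using r by (auto simp: conic_def less_imp_le dest: pos)
  then show "balanced N \<S>"
    unfolding balanced_def using nt by blast
qed

lemma semi_conicI:
  assumes "\<And>S. S \<in> \<S> - {Y} \<Longrightarrow> l S \<ge> 0"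
  shows "semi_conic \<S> l"
proof -
  have "S = Y" if "S \<in> \<S>" "l S < 0" for S
    using assms[of S] that by force
  then show ?thesis
    unfolding semi_conic_def Uniq_def by metis
qed

lemma balanced_imp_semi_balanced:
  assumes "finite N" "balanced N \<S>"
  shows "semi_balanced N \<S>"
proof -
  obtain l where "nontrivial_system N \<S>" "\<forall>S\<in>\<S>. l S > 0" "constant_on N (lin_comb \<S> l)"
    using assms balanced_iff by blast
  then show ?thesis
    unfolding semi_balanced_def semi_conic_def Uniq_def by (metis less_irrefl less_asym)
qed

text \<open>Dropping zero coefficients does not change the vector, and the remaining ones are
  positive. The set \<open>A\<close> keeps the support from being empty.\<close>

lemma balanced_support:
  assumes "finite N" "nontrivial_system N \<S>" "\<And>S. S \<in> \<S> \<Longrightarrow> l S \<ge> 0"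
    "constant_on N (lin_comb \<S> l)" "A \<in> \<S>" "l A \<noteq> 0"
  shows "balanced N {S \<in> \<S>. l S \<noteq> 0}"
proof -
  have "nontrivial_system N {S \<in> \<S>. l S \<noteq> 0}"
    using assms(2,5,6) unfolding nontrivial_system_def by auto
  moreover have "constant_on N (lin_comb {S \<in> \<S>. l S \<noteq> 0} l)"
    using assms(4) lin_comb_support[OF finite_system[OF assms(1,2)]] by simp
  moreover have "\<forall>S\<in>{S \<in> \<S>. l S \<noteq> 0}. l S > 0"
    using assms(3) by (simp add: order_less_le)
  ultimately show ?thesis
    using assms(1) balanced_iff by blast
qed

lemma semi_balanced_support:
  assumes "finite N" "nontrivial_system N \<S>" "semi_conic \<S> l"
    "constant_on N (lin_comb \<S> l)" "A \<in> \<S>" "l A \<noteq> 0"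
  shows "semi_balanced N {S \<in> \<S>. l S \<noteq> 0}"
proof -
  have "nontrivial_system N {S \<in> \<S>. l S \<noteq> 0}"
    using assms(2,5,6) unfolding nontrivial_system_def by auto
  moreover have "constant_on N (lin_comb {S \<in> \<S>. l S \<noteq> 0} l)"
    using assms(4) lin_comb_support[OF finite_system[OF assms(1,2)]] by simp
  moreover have "semi_conic {S \<in> \<S>. l S \<noteq> 0} l"
    using assms(3) unfolding semi_conic_def Uniq_def by blast
  ultimately show ?thesis
    unfolding semi_balanced_def by blast
qed

section \<open>Rigidity of combinations on minimal systems\<close>

text \<open>All or nothing: if some but not all coefficients vanished, the support would be a
  strictly smaller balanced system.\<close>

lemma min_balanced_nonzero:
  assumes "finite N" "min_balanced N \<B>" "\<And>S. S \<in> \<B> \<Longrightarrow> l S \<ge> 0"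
    "constant_on N (lin_comb \<B> l)" "A \<in> \<B>" "l A \<noteq> 0" "B \<in> \<B>"
  shows "l B \<noteq> 0"
proof
  assume "l B = 0"
  then have "{S \<in> \<B>. l S \<noteq> 0} \<subset> \<B>"
    using assms(7) by blast
  moreover have "balanced N {S \<in> \<B>. l S \<noteq> 0}"
    using balanced_support[OF assms(1) _ assms(3-6)] assms(2)
    by (simp add: min_balanced_def balanced_def)
  ultimately show False
    using assms(2) unfolding min_balanced_def by blast
qed

text \<open>The same all-or-nothing principle for semi-conic combinations, the support now being
  semi-balanced.\<close>

lemma min_semi_balanced_nonzero:
  assumes "finite N" "min_semi_balanced N \<S>" "semi_conic \<S> l"
    "constant_on N (lin_comb \<S> l)" "A \<in> \<S>" "l A \<noteq> 0" "B \<in> \<S>"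
  shows "l B \<noteq> 0"
proof
  assume "l B = 0"
  then have "{S \<in> \<S>. l S \<noteq> 0} \<subset> \<S>"
    using assms(7) by blast
  moreover have "semi_balanced N {S \<in> \<S>. l S \<noteq> 0}"
    using semi_balanced_support[OF assms(1) _ assms(3-6)] assms(2)
    by (simp add: min_semi_balanced_def semi_balanced_def)
  ultimately show False
    using assms(2) unfolding min_semi_balanced_def by blast
qed

lemma min_balanced_combination_unique:
  assumes "finite N" "min_balanced N \<B>"
    "\<And>S. S \<in> \<B> \<Longrightarrow> l S > 0" "constant_on N (lin_comb \<B> l)"
    "constant_on N (lin_comb \<B> m)"
  obtains t where "\<And>S. S \<in> \<B> \<Longrightarrow> m S = t * l S"
proof -
  have nt: "nontrivial_system N \<B>"
    using assms(2) by (simp add: min_balanced_def balanced_def)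
  then have fin: "finite \<B>" "\<B> \<noteq> {}"
    using finite_system[OF assms(1)] by (auto simp: nontrivial_system_def)
  \<comment> \<open>The least factor for which \<open>t * l - m\<close> is conic. The maximum is
    attained at some \<open>B\<close>, where this difference vanishes, so the all-or-nothing
    principle makes it vanish everywhere.\<close>
  define t where "t = Max ((\<lambda>S. m S / l S) ` \<B>)"
  define k where "k S = t * l S + (- 1) * m S" for S
  have "k S \<ge> 0" if "S \<in> \<B>" for S
  proof -
    have "m S / l S \<le> t"
      unfolding t_def using fin that by simp
    then show ?thesis
      using assms(3)[OF that] by (simp add: k_def pos_divide_le_eq)
  qed
  note k_nonneg = this
  obtain B where B: "B \<in> \<B>" "k B = 0"
  proof -
    have "t \<in> (\<lambda>S. m S / l S) ` \<B>"
      unfolding t_def using fin by (intro Max_in) auto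
    then obtain B where "B \<in> \<B>" "t = m B / l B"
      by blast
    then show ?thesis
      using that assms(3)[of B] by (simp add: k_def)
  qed
  have "constant_on N (lin_comb \<B> k)"
    unfolding k_def using assms(4,5) by (rule constant_on_linear)
  then have "k S = 0" if "S \<in> \<B>" for S
    using min_balanced_nonzero[OF assms(1,2), of k S B] k_nonneg B that by blast
  then have "m S = t * l S" if "S \<in> \<B>" for S
    using that by (simp add: k_def)
  then show ?thesis
    by (rule that)
qed

section \<open>Complementary pairs\<close>

lemma balanced_complementary_pair:
  assumes "finite N" "Z \<subseteq> N" "Z \<noteq> {}" "Z \<noteq> N"
  shows "balanced N {Z, N - Z}"
proof -
  \<comment> \<open>Distinctness ensures that the sum over \<open>{Z, N - Z}\<close> really has two
    summands, exactly one of which is 1 at each point of \<open>N\<close>.\<close>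
  have "Z \<noteq> N - Z"
    using assms by blast
  then have "lin_comb {Z, N - Z} (\<lambda>_. 1) i = 1" if "i \<in> N" for i
    using that by (simp add: lin_comb_def indicator_def del: sum_of_bool_eq)
  then have "constant_on N (lin_comb {Z, N - Z} (\<lambda>_. 1))"
    by (auto simp: constant_on_def)
  moreover have "nontrivial_system N {Z, N - Z}"
    using assms by (auto simp: nontrivial_system_def)
  ultimately show ?thesis
    using balanced_iff[OF assms(1)] by (meson zero_less_one)
qed

text \<open>A complementary pair is balanced on its own, and by cardinality it would be a strict
  subsystem.\<close>

lemma min_balanced_complement_notin:
  assumes "finite N" "min_balanced N \<B>" "card \<B> \<ge> 3" "Z \<in> \<B>"
  shows "N - Z \<notin> \<B>"
proof
  assume Y: "N - Z \<in> \<B>"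
  have "{Z, N - Z} \<noteq> \<B>"
    using assms(3) by (auto simp: card_insert_if split: if_splits)
  then have "{Z, N - Z} \<subset> \<B>"
    using Y assms(4) by blast
  moreover have "balanced N {Z, N - Z}"
    using assms(2,4) by (intro balanced_complementary_pair[OF assms(1)])
      (auto simp: min_balanced_def balanced_def nontrivial_system_def)
  ultimately show False
    using assms(2) unfolding min_balanced_def by blast
qed

section \<open>From min-balanced to purely min-semi-balanced systems\<close>

text \<open>The combinations on \<open>\<S>\<close> yielding constants are the multiples of one
  combination that is negative at \<open>N - Z\<close> and positive elsewhere. Minimality, pureness
  and the uniqueness of the exceptional set are all read off from the sign of the factor.\<close>

lemma min_balanced_exchange:
  assumes "finite N" "min_balanced N \<B>" "card \<B> \<ge> 3" "Z \<in> \<B>"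
  defines "\<S> \<equiv> \<B> - {Z} \<union> {N - Z}"
  shows "purely_min_semi_balanced N \<S>" "exceptional N \<S> (N - Z)"
    "\<And>T. exceptional N \<S> T \<Longrightarrow> T = N - Z"
proof -
  define Y where "Y = N - Z"
  have Y: "Y \<notin> \<B>"
    unfolding Y_def using assms by (intro min_balanced_complement_notin)
  have "balanced N \<B>"
    using assms(2) by (simp add: min_balanced_def)
  then obtain l where nt: "nontrivial_system N \<B>" and l: "\<And>S. S \<in> \<B> \<Longrightarrow> l S > 0"
      and cl: "constant_on N (lin_comb \<B> l)"
    using balanced_iff[OF assms(1)] by blast
  have fin: "finite \<B>"
    using assms(1) nt by (rule finite_system)
  have ZN: "Z \<subseteq> N"
    using nt assms(4) by (auto simp: nontrivial_system_def)
  then have Z: "N - Y = Z"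
    by (auto simp: Y_def)
  have S: "\<S> = \<B> - {Z} \<union> {Y}"
    by (simp add: \<S>_def Y_def)
  have Z_notin: "Z \<notin> \<S>"
    using Y assms(4) by (auto simp: S)
  have ntS: "nontrivial_system N \<S>"
    unfolding \<S>_def using nt assms(4) by (rule nontrivial_exchange)
  have finS: "finite \<S>"
    using fin by (simp add: S)
  have B: "\<S> - {Y} \<union> {Z} = \<B>"
    using Y assms(4) by (auto simp: S)

  \<comment> \<open>Exchanging \<open>Y\<close> back for \<open>N - Y = Z\<close> carries
    \<open>m\<close> to a combination on \<open>\<B>\<close>, which is a multiple of
    \<open>l\<close>; the sign flips only at \<open>Y\<close>.\<close>
  have unique: "\<exists>t. m Y = - t * l Z \<and> (\<forall>S\<in>\<B> - {Z}. m S = t * l S)"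
    if "constant_on N (lin_comb \<S> m)" for m
  proof -
    have "constant_on N (lin_comb (\<S> - {Y} \<union> {N - Y}) (m(N - Y := - m Y)))"
      using finS Z_notin that by (intro constant_on_exchange) (auto simp: S Z)
    then have "constant_on N (lin_comb \<B> (m(Z := - m Y)))"
      by (simp only: Z B)
    then obtain t where t: "\<And>S. S \<in> \<B> \<Longrightarrow> (m(Z := - m Y)) S = t * l S"
      using min_balanced_combination_unique[OF assms(1,2) l cl] by metis
    show ?thesis
    proof (intro exI conjI ballI)
      show "m Y = - t * l Z"
        using t[OF assms(4)] by simp
      show "m S = t * l S" if "S \<in> \<B> - {Z}" for S
        using t[of S] that by simp
    qed
  qed
  \<comment> \<open>Here \<open>card \<B> \<ge> 3\<close> enters: \<open>\<B> - {Z}\<close> has at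
    least two members, so one differs from any given \<open>T\<close>.\<close>
  have other: "\<exists>S\<in>\<B> - {Z}. S \<noteq> T" for T
  proof (rule ccontr)
    assume "\<not> ?thesis"
    then have "\<B> \<subseteq> {Z, T}"
      by auto
    then have "card \<B> \<le> card {Z, T}"
      by (simp add: card_mono)
    also have "\<dots> \<le> 2"
      by (simp add: card_insert_if)
    finally show False
      using assms(3) by simp
  qed

  define k where "k = l(Y := - l Z)"
  have ck: "constant_on N (lin_comb \<S> k)"
    unfolding \<S>_def k_def Y_def using fin assms(4) Y cl
    by (intro constant_on_exchange) (auto simp: Y_def)
  have k: "k S > 0" if "S \<in> \<S> - {Y}" for S
    using that l assms(4) by (auto simp: k_def S)
  have kY: "k Y < 0"
    using l[OF assms(4)] by (simp add: k_def)
  show "exceptional N \<S> (N - Z)"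
    unfolding exceptional_def Y_def[symmetric]
    using ck kY k by (intro conjI exI[of _ k] ballI) (simp_all add: S less_imp_le)
  have "semi_conic \<S> k"
    using k by (intro semi_conicI[of _ Y]) (simp add: less_imp_le)
  moreover have "\<forall>S\<in>\<S>. k S \<noteq> 0"
    using k kY by force
  ultimately have "semi_balanced N \<S>"
    unfolding semi_balanced_def using ntS ck by blast
  moreover have "\<not> semi_balanced N \<T>" if "\<T> \<subset> \<S>" for \<T>
  proof
    assume "semi_balanced N \<T>"
    then obtain m where m: "\<forall>S\<in>\<T>. m S \<noteq> 0" "constant_on N (lin_comb \<T> m)" "\<T> \<noteq> {}"
      unfolding semi_balanced_def nontrivial_system_def by blast
    \<comment> \<open>Extended by zero, \<open>m\<close> becomes a multiple of the fixed combination
      on \<open>\<S>\<close>. A set missing from \<open>\<T>\<close> forces the factor to be 0, so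
      all coefficients vanish, against those on \<open>\<T>\<close>.\<close>
    define m' where "m' S = (if S \<in> \<T> then m S else 0)" for S
    have "constant_on N (lin_comb \<S> m')"
      unfolding m'_def using lin_comb_extend_zero[OF finS, of \<T> m] m(2) that by auto
    then obtain t where t: "m' Y = - t * l Z" "\<forall>S\<in>\<B> - {Z}. m' S = t * l S"
      using unique[of m'] by blast
    obtain A where "A \<in> \<S>" "A \<notin> \<T>"
      using \<open>\<T> \<subset> \<S>\<close> by blast
    moreover from this have "m' A = 0"
      by (simp add: m'_def)
    ultimately have "t = 0"
      using t l[OF assms(4)] l[of A] Z_notin by (cases "A = Y") (auto simp: S)
    then have zero: "m' S = 0" if "S \<in> \<S>" for S
      using t that by (auto simp: S)
    obtain B where "B \<in> \<T>"
      using m(3) by blast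
    then show False
      using m(1) zero[of B] \<open>\<T> \<subset> \<S>\<close> by (auto simp: m'_def)
  qed
  moreover have "\<not> balanced N \<S>"
  proof
    assume "balanced N \<S>"
    then obtain m where m: "\<forall>S\<in>\<S>. m S > 0" "constant_on N (lin_comb \<S> m)"
      using balanced_iff[OF assms(1)] by blast
    obtain t where t: "m Y = - t * l Z" "\<forall>S\<in>\<B> - {Z}. m S = t * l S"
      using unique[OF m(2)] by blast
    \<comment> \<open>A positive coefficient at \<open>A\<close> requires \<open>t > 0\<close>, one
      at \<open>Y\<close> requires \<open>t < 0\<close>.\<close>
    obtain A where A: "A \<in> \<B> - {Z}"
      using other by blast
    then have "t * l A > 0" "- t * l Z > 0"
      using t m(1) by (auto simp: S)
    then show False
      using l[OF assms(4)] l[of A] A by (auto simp: zero_less_mult_iff mult_less_0_iff)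
  qed
  ultimately show "purely_min_semi_balanced N \<S>"
    unfolding purely_min_semi_balanced_def min_semi_balanced_def by blast

  fix T assume "exceptional N \<S> T"
  then obtain m where T: "T \<in> \<S>" and m: "constant_on N (lin_comb \<S> m)" "m T < 0"
      "\<forall>S\<in>\<S> - {T}. m S \<ge> 0"
    unfolding exceptional_def by blast
  obtain t where t: "\<forall>S\<in>\<B> - {Z}. m S = t * l S"
    using unique[OF m(1)] by blast
  show "T = N - Z"
  proof (rule ccontr)
    assume "T \<noteq> N - Z"
    then have TB: "T \<in> \<B> - {Z}"
      using T by (auto simp: \<S>_def)
    \<comment> \<open>Both \<open>m T\<close> and \<open>m A\<close> have the sign of
      \<open>t\<close>, so \<open>m T < 0\<close> would make \<open>m A\<close> a second negative
      coefficient.\<close>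
    obtain A where A: "A \<in> \<B> - {Z}" "A \<noteq> T"
      using other by blast
    have "m A \<ge> 0"
      using m(3) A by (simp add: S)
    then have "t * l T < 0" "t * l A \<ge> 0"
      using t TB A m(2) by force+
    then show False
      using l[of T] l[of A] A TB by (auto simp: zero_le_mult_iff mult_less_0_iff)
  qed
qed

section \<open>From min-semi-balanced to min-balanced systems\<close>

text \<open>A non-zero multiple of one incidence vector of a proper non-empty subset is not
  constant. With just one further set \<open>W\<close>, comparing values at suitable points first
  forces \<open>Y \<subseteq> W\<close> and then a contradiction.\<close>

lemma exceptional_combination_card:
  assumes "nontrivial_system N \<S>" "finite \<S>" "Y \<in> \<S>" "constant_on N (lin_comb \<S> m)" "m Y < 0"
    "\<And>S. S \<in> \<S> - {Y} \<Longrightarrow> m S > 0"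
  shows "card \<S> \<ge> 3"
proof (rule ccontr)
  assume "\<not> card \<S> \<ge> 3"
  then have card: "card (\<S> - {Y}) \<le> 1"
    using assms(2,3) by (simp add: card_Diff_singleton)
  obtain r where r: "\<And>i. i \<in> N \<Longrightarrow> lin_comb \<S> m i = r"
    using assms(4) by (auto simp: constant_on_def)
  have Y: "Y \<subset> N" "Y \<noteq> {}"
    using assms(1,3) by (auto simp: nontrivial_system_def)
  show False
  proof (cases "\<S> - {Y} = {}")
    case True
    then have "\<S> = {Y}"
      using assms(3) by blast
    then have "m Y * indicator Y i = r" if "i \<in> N" for i
      using r[OF that] by (simp add: lin_comb_def)
    moreover obtain i j where "i \<in> Y" "i \<in> N" "j \<in> N" "j \<notin> Y"
      using Y by blast
    ultimately have "m Y * indicator Y i = m Y * indicator Y j"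
      by metis
    with \<open>i \<in> Y\<close> \<open>j \<notin> Y\<close> have "m Y = 0"
      by simp
    then show False
      using assms(5) by simp
  next
    case False
    then have "card (\<S> - {Y}) = 1"
      using card assms(2) by (simp add: le_Suc_eq)
    then obtain W where "\<S> - {Y} = {W}"
      by (rule card_1_singletonE)
    moreover from this have "W \<in> \<S> - {Y}"
      by simp
    ultimately have W: "\<S> = {Y, W}" "W \<noteq> Y" "W \<in> \<S>" "m W > 0"
      using assms(3) assms(6)[of W] by auto
    then have WN: "W \<subset> N"
      using assms(1) by (auto simp: nontrivial_system_def)
    have eq: "m Y * indicator Y i + m W * indicator W i = r" if "i \<in> N" for i
      using r[OF that] W by (simp add: lin_comb_def)
    \<comment> \<open>A point of \<open>Y\<close> outside \<open>W\<close> would have the value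
      \<open>m Y < 0\<close>, whereas points outside \<open>Y\<close> have value at least 0.\<close>
    have "Y \<subseteq> W"
    proof
      fix i assume "i \<in> Y"
      moreover obtain j where "j \<in> N" "j \<notin> Y"
        using Y by blast
      ultimately show "i \<in> W"
        using eq[of i] eq[of j] psubsetD[OF Y(1), of i] W(4) assms(5)
        by (cases "i \<in> W"; cases "j \<in> W") simp_all
    qed
    moreover obtain j where "j \<in> N" "j \<notin> W"
      using WN by blast
    \<comment> \<open>The value is \<open>m W > 0\<close> at \<open>i\<close>, but 0 at
      \<open>j\<close>, which lies outside both sets.\<close>
    moreover obtain i where "i \<in> W" "i \<notin> Y"
      using calculation(1) W(2) by blast
    ultimately show False
      using eq[of i] eq[of j] psubsetD[OF WN, of i] W(4) by (cases "j \<in> Y") auto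
  qed
qed

text \<open>Minimality makes every coefficient of an exceptional combination non-zero, so the
  exchange, which negates the only negative one, gives a positive combination. For minimality, the
  exchange also matches zero coefficients on both sides.\<close>

lemma min_semi_balanced_exchange:
  assumes "finite N" "min_semi_balanced N \<S>" "exceptional N \<S> Y"
  defines "\<B> \<equiv> \<S> - {Y} \<union> {N - Y}"
  shows "N - Y \<notin> \<S>" "min_balanced N \<B>" "card \<B> \<ge> 3"
proof -
  define Z where "Z = N - Y"
  obtain m where Y: "Y \<in> \<S>" and m: "constant_on N (lin_comb \<S> m)" "m Y < 0"
      "\<forall>S\<in>\<S> - {Y}. m S \<ge> 0"
    using assms(3) unfolding exceptional_def by blast
  have nt: "nontrivial_system N \<S>"
    using assms(2) by (simp add: min_semi_balanced_def semi_balanced_def)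
  have fin: "finite \<S>"
    using assms(1) nt by (rule finite_system)
  have YN: "Y \<subseteq> N" "Y \<noteq> {}" "Y \<noteq> N"
    using nt Y by (auto simp: nontrivial_system_def)
  have "semi_conic \<S> m"
    using m(3) by (intro semi_conicI[of _ Y]) simp
  then have "m S \<noteq> 0" if "S \<in> \<S>" for S
    using min_semi_balanced_nonzero[OF assms(1,2), of m Y S] m(1,2) Y that by simp
  then have pos: "m S > 0" if "S \<in> \<S> - {Y}" for S
    using m(3) that by (simp add: order_less_le)
  have card: "card \<S> \<ge> 3"
    using nt fin Y m(1,2) pos by (rule exceptional_combination_card)
  have Z: "Z \<notin> \<S>"
  proof
    assume "Z \<in> \<S>"
    \<comment> \<open>By minimality this pair would have to be all of \<open>\<S>\<close>,
      contradicting its cardinality.\<close>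
    have "semi_balanced N {Y, Z}"
      unfolding Z_def using assms(1) YN
      by (intro balanced_imp_semi_balanced balanced_complementary_pair)
    then have "\<not> {Y, Z} \<subset> \<S>"
      using assms(2) unfolding min_semi_balanced_def by blast
    then have "\<S> = {Y, Z}"
      using \<open>Z \<in> \<S>\<close> Y by (simp add: psubset_eq)
    then show False
      using card by (simp add: card_insert_if split: if_splits)
  qed
  then show "N - Y \<notin> \<S>"
    by (simp add: Z_def)
  have B: "\<B> = \<S> - {Y} \<union> {Z}"
    by (simp add: \<B>_def Z_def)
  then have "\<B> = insert Z (\<S> - {Y})" "Z \<notin> \<S> - {Y}"
    using Z by auto
  then show "card \<B> \<ge> 3"
    using card fin Y by (simp add: card_Diff_singleton)
  have finB: "finite \<B>"
    using fin by (simp add: B)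
  have ntB: "nontrivial_system N \<B>"
    unfolding \<B>_def using nt Y by (rule nontrivial_exchange)
  have Y_notin: "Y \<notin> \<B>" and ZB: "Z \<in> \<B>" and NZ: "N - Z = Y"
    using Z Y YN(1) by (auto simp: B Z_def)
  have S: "\<B> - {Z} \<union> {Y} = \<S>"
    using Z Y by (auto simp: B)
  have "constant_on N (lin_comb \<B> (m(Z := - m Y)))"
    unfolding \<B>_def Z_def using fin Y Z m(1) by (intro constant_on_exchange) (auto simp: Z_def)
  moreover have "\<forall>S\<in>\<B>. (m(Z := - m Y)) S > 0"
    using pos m(2) by (auto simp: B)
  ultimately have "balanced N \<B>"
    using balanced_iff[OF assms(1)] ntB by blast
  moreover have "\<not> balanced N \<T>" if "\<T> \<subset> \<B>" for \<T>
  proof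
    assume "balanced N \<T>"
    then obtain k where k: "\<forall>S\<in>\<T>. k S > 0" "constant_on N (lin_comb \<T> k)" "\<T> \<noteq> {}"
      unfolding balanced_iff[OF assms(1)] nontrivial_system_def by blast
    define n where "n S = (if S \<in> \<T> then k S else 0)" for S
    \<comment> \<open>The exchange applied to the zero extension \<open>n\<close>. As
      \<open>n\<close> is non-negative, only the coefficient at \<open>Y\<close> can be negative, so
      \<open>n'\<close> is semi-conic and the all-or-nothing principle applies to it.\<close>
    define n' where "n' = n(Y := - n Z)"
    have n: "n S \<ge> 0" for S
      using k(1) by (simp add: n_def less_imp_le)
    have "constant_on N (lin_comb \<B> n)"
      unfolding n_def using lin_comb_extend_zero[OF finB, of \<T> k] k(2) that by auto
    then have "constant_on N (lin_comb (\<B> - {Z} \<union> {N - Z}) (n(N - Z := - n Z)))"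
      using finB ZB Y_notin by (intro constant_on_exchange) (auto simp: NZ)
    then have "constant_on N (lin_comb \<S> n')"
      by (simp only: NZ S n'_def)
    moreover have "semi_conic \<S> n'"
      using n by (intro semi_conicI[of _ Y]) (simp add: n'_def)
    ultimately have same: "n' A \<noteq> 0 \<Longrightarrow> n' B \<noteq> 0" if "A \<in> \<S>" "B \<in> \<S>" for A B
      using min_semi_balanced_nonzero[OF assms(1,2), of n' A B] that by blast
    \<comment> \<open>Pairing \<open>Z\<close> with \<open>Y\<close> and every other set with itself
      preserves vanishing. Hence a zero and a non-zero coefficient of \<open>n\<close> yield the
      same for \<open>n'\<close>, which is impossible.\<close>
    have *: "\<exists>B\<in>\<S>. n' B = 0 \<longleftrightarrow> n A = 0" if "A \<in> \<B>" for A
    proof (cases "A = Z")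
      case True
      then show ?thesis
        using Y by (intro bexI[of _ Y]) (simp_all add: n'_def)
    next
      case False
      then have "A \<in> \<S>" "A \<noteq> Y"
        using that Y_notin by (auto simp: B)
      then show ?thesis
        by (intro bexI[of _ A]) (simp_all add: n'_def)
    qed
    obtain A B where "A \<in> \<B>" "A \<notin> \<T>" "B \<in> \<T>"
      using \<open>\<T> \<subset> \<B>\<close> k(3) by blast
    then have "A \<in> \<B>" "n A = 0" "B \<in> \<B>" "n B \<noteq> 0"
      using \<open>\<T> \<subset> \<B>\<close> k(1) by (auto simp: n_def)
    then obtain A' B' where "A' \<in> \<S>" "n' A' = 0" "B' \<in> \<S>" "n' B' \<noteq> 0"
      using *[of A] *[of B] by blast
    then show False
      using same[of B' A'] by blast
  qed
  ultimately show "min_balanced N \<B>"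
    unfolding min_balanced_def by blast
qed

theorem lemma13:
  fixes N :: "'a set"
  assumes "finite N" and "card N \<ge> 3"
  shows
    "(\<forall>\<B> Z. min_balanced N \<B> \<and> card \<B> \<ge> 3 \<and> Z \<in> \<B> \<longrightarrow>
        (let Y = N - Z; \<S> = (\<B> - {Z}) \<union> {Y} in
           Y \<notin> \<B> \<and> purely_min_semi_balanced N \<S> \<and>
           exceptional N \<S> Y \<and> (\<forall>T. exceptional N \<S> T \<longrightarrow> T = Y))) \<and>
     (\<forall>\<S> Y. min_semi_balanced N \<S> \<and> exceptional N \<S> Y \<longrightarrow>
        (let Z = N - Y; \<B> = (\<S> - {Y}) \<union> {Z} in
           Z \<notin> \<S> \<and> min_balanced N \<B> \<and> card \<B> \<ge> 3))"
proof (intro conjI allI impI; elim conjE)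
  fix \<B> Z
  assume "min_balanced N \<B>" "3 \<le> card \<B>" "Z \<in> \<B>"
  note B = assms(1) this
  show "let Y = N - Z; \<S> = (\<B> - {Z}) \<union> {Y} in
      Y \<notin> \<B> \<and> purely_min_semi_balanced N \<S> \<and>
      exceptional N \<S> Y \<and> (\<forall>T. exceptional N \<S> T \<longrightarrow> T = Y)"
    unfolding Let_def
    using min_balanced_complement_notin[OF B] min_balanced_exchange[OF B] by (intro conjI allI impI)
next
  fix \<S> Y
  assume "min_semi_balanced N \<S>" "exceptional N \<S> Y"
  note S = assms(1) this
  show "let Z = N - Y; \<B> = (\<S> - {Y}) \<union> {Z} in
      Z \<notin> \<S> \<and> min_balanced N \<B> \<and> card \<B> \<ge> 3"
    unfolding Let_def using min_semi_balanced_exchange[OF S] by (intro conjI)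
qed

end
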